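(* Let $k \ge 2$ be an integer, let $U$ be a finite nonempty set, and let $f : \{0,\ldots,k\}^U \to \mathbb{R}_{+}$. Then $f$ is $k$-submodular if and only if $f$ is both submodular in every orthant and pairwise monotone.
   Context: $\mathbb{R}_{+}$ denotes the non-negative reals. For $s,t\in\{0,\ldots,k\}$ define $\mathrm{min}_0(s,t)=0$ if $s\neq 0$, $t\neq 0$ and $s\neq t$, and $\mathrm{min}_0(s,t)=\min(s,t)$ otherwise; define $\mathrm{max}_0(s,t)=0$ if $s\neq 0$, $t\neq 0$ and $s\neq t$, and $\mathrm{max}_0(s,t)=\max(s,t)$ otherwise. Both operations are applied coordinate-wise to vectors in $\{0,\ldots,k\}^U$. $f$ is $k$-submodular if $f(\mathbf{s})+f(\mathbf{t})\ge f(\mathrm{min}_0(\mathbf{s},\mathbf{t}))+f(\mathrm{max}_0(\mathbf{s},\mathbf{t}))$ for all $\mathbf{s},\mathbf{t}\in\{0,\ldots,k\}^U$. Vectors in $\{0,\ldots,k\}^U$ are called partial solutions; an orthant is a vector $\mathbf{x}\in\{1,\ldots,k\}^U$ (no zero coordinate). A partial solution $\mathbf{s}$ is in orthant $\mathbf{x}$ if $s_e\in\{0,x_e\}$ for all $e\in U$. $f$ is submodular in every orthant if for any two partial solutions $\mathbf{a},\mathbf{b}$ lying in a common orthant, $f(\mathbf{a})+f(\mathbf{b})\ge f(\mathrm{min}_0(\mathbf{a},\mathbf{b}))+f(\mathrm{max}_0(\mathbf{a},\mathbf{b}))$. For $e\in U$, $i\in\{1,\ldots,k\}$ and $\mathbf{s}$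 with $s_e=0$, the marginal is $f_{i,e}(\mathbf{s})=f(\mathbf{s}+i\cdot\mathbf{1}_e)-f(\mathbf{s})$, where $\mathbf{1}_e$ is the unit vector of coordinate $e$. $f$ is pairwise monotone (i.e. $2$-wise monotone) if $f_{i,e}(\mathbf{s})+f_{j,e}(\mathbf{s})\ge 0$ for every $e\in U$, every $\mathbf{s}$ with $s_e=0$, and all distinct $i,j\in\{1,\ldots,k\}$. *)

theory Defs
  imports Complex_Main "HOL-Library.FuncSet"
begin

text \<open>
  Vectors indexed by a finite set \<open>U\<close> are extensional functions on \<open>U\<close>, so that
  equality of vectors is equality of functions, and \<open>U \<rightarrow>\<^sub>E {0..k}\<close> is exactly
  the set of vectors with coordinates in \<open>{0..k}\<close>.
\<close>

definition partial_solutions :: "'u set \<Rightarrow> nat \<Rightarrow> ('u \<Rightarrow> nat) set" where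
  "partial_solutions U k = (U \<rightarrow>\<^sub>E {0..k})"

definition orthants :: "'u set \<Rightarrow> nat \<Rightarrow> ('u \<Rightarrow> nat) set" where
  "orthants U k = (U \<rightarrow>\<^sub>E {1..k})"

definition in_orthant :: "'u set \<Rightarrow> ('u \<Rightarrow> nat) \<Rightarrow> ('u \<Rightarrow> nat) \<Rightarrow> bool" where
  "in_orthant U s x \<longleftrightarrow> (\<forall>e\<in>U. s e \<in> {0, x e})"

definition min0 :: "nat \<Rightarrow> nat \<Rightarrow> nat" where
  "min0 s t = (if s \<noteq> 0 \<and> t \<noteq> 0 \<and> s \<noteq> t then 0 else min s t)"

definition max0 :: "nat \<Rightarrow> nat \<Rightarrow> nat" where
  "max0 s t = (if s \<noteq> 0 \<and> t \<noteq> 0 \<and> s \<noteq> t then 0 else max s t)"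

definition vmin0 :: "'u set \<Rightarrow> ('u \<Rightarrow> nat) \<Rightarrow> ('u \<Rightarrow> nat) \<Rightarrow> ('u \<Rightarrow> nat)" where
  "vmin0 U s t = (\<lambda>e\<in>U. min0 (s e) (t e))"

definition vmax0 :: "'u set \<Rightarrow> ('u \<Rightarrow> nat) \<Rightarrow> ('u \<Rightarrow> nat) \<Rightarrow> ('u \<Rightarrow> nat)" where
  "vmax0 U s t = (\<lambda>e\<in>U. max0 (s e) (t e))"

lemma vmin0_closed:
  "s \<in> partial_solutions U k \<Longrightarrow> t \<in> partial_solutions U k \<Longrightarrow> vmin0 U s t \<in> partial_solutions U k"
  by (auto simp: partial_solutions_def vmin0_def min0_def PiE_iff min_def)

lemma vmax0_closed:
  "s \<in> partial_solutions U k \<Longrightarrow> t \<in> partial_solutions U k \<Longrightarrow> vmax0 U s t \<in> partial_solutions U k"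
  by (auto simp: partial_solutions_def vmax0_def max0_def PiE_iff max_def)

definition k_submodular :: "'u set \<Rightarrow> nat \<Rightarrow> (('u \<Rightarrow> nat) \<Rightarrow> real) \<Rightarrow> bool" where
  "k_submodular U k f \<longleftrightarrow>
     (\<forall>s\<in>partial_solutions U k. \<forall>t\<in>partial_solutions U k.
        f s + f t \<ge> f (vmin0 U s t) + f (vmax0 U s t))"

definition submodular_in_every_orthant ::
    "'u set \<Rightarrow> nat \<Rightarrow> (('u \<Rightarrow> nat) \<Rightarrow> real) \<Rightarrow> bool" where
  "submodular_in_every_orthant U k f \<longleftrightarrow>
     (\<forall>a\<in>partial_solutions U k. \<forall>b\<in>partial_solutions U k.
        (\<exists>x\<in>orthants U k. in_orthant U a x \<and> in_orthant U b x) \<longrightarrow>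
        f a + f b \<ge> f (vmin0 U a b) + f (vmax0 U a b))"

text \<open>
  The update below is the vector \<open>s\<close> plus \<open>i\<close> times the unit vector of coordinate \<open>e\<close>.
  The marginal is meaningful only if \<open>e \<in> U\<close>, \<open>i \<in> {1..k}\<close> and \<open>s e = 0\<close>; these side
  conditions are imposed where it is used.
\<close>

definition marginal :: "(('u \<Rightarrow> nat) \<Rightarrow> real) \<Rightarrow> nat \<Rightarrow> 'u \<Rightarrow> ('u \<Rightarrow> nat) \<Rightarrow> real" where
  "marginal f i e s = f (s(e := s e + i)) - f s"

definition pairwise_monotone :: "'u set \<Rightarrow> nat \<Rightarrow> (('u \<Rightarrow> nat) \<Rightarrow> real) \<Rightarrow> bool" where
  "pairwise_monotone U k f \<longleftrightarrow>
     (\<forall>e\<in>U. \<forall>s\<in>partial_solutions U k. s e = 0 \<longrightarrow>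
        (\<forall>i\<in>{1..k}. \<forall>j\<in>{1..k}. i \<noteq> j \<longrightarrow> marginal f i e s + marginal f j e s \<ge> 0))"

end

theory Submission
  imports Defs
begin

text \<open>
  For the hard direction, let \<open>D\<close> be the set of coordinates where \<open>a\<close> and \<open>b\<close> conflict, let
  \<open>a\<^sub>0\<close>, \<open>b\<^sub>0\<close> be \<open>a\<close>, \<open>b\<close> with \<open>D\<close> zeroed, and let \<open>m\<close> be their maximum.
  Submodularity in orthants for the pairs \<open>(a\<^sub>0, b\<^sub>0)\<close>, \<open>(a, m)\<close> and \<open>(b, m)\<close> reduces the
  claim to \<open>f (m + a\<^sub>D) + f (m + b\<^sub>D) \<ge> 2 f m\<close>, where \<open>a\<^sub>D\<close>, \<open>b\<^sub>D\<close> are the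
  restrictions to \<open>D\<close>. That inequality extends pairwise monotonicity from one coordinate to
  a set of coordinates, by induction on \<open>D\<close>.
\<close>

lemma override_on_partial_solutions:
  assumes "m \<in> partial_solutions U k" "p \<in> partial_solutions U k"
  shows "override_on m p D \<in> partial_solutions U k"
  using assms by (auto simp: partial_solutions_def PiE_iff override_on_def extensional_def)

text \<open>Replaces the existential over orthants by a coordinatewise test: vectors that nowhere
  conflict share an orthant.\<close>

lemma submodular_in_every_orthantD:
  assumes sub: "submodular_in_every_orthant U k f" and k: "k \<ge> 1"
    and a: "a \<in> partial_solutions U k" and b: "b \<in> partial_solutions U k"
    and compat: "\<And>e. e \<in> U \<Longrightarrow> a e = 0 \<or> b e = 0 \<or> a e = b e"
  shows "f a + f b \<ge> f (vmin0 U a b) + f (vmax0 U a b)"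
proof -
  \<comment> \<open>Where both vectors vanish any nonzero value would do; \<open>1\<close> is legal
    since \<open>k \<ge> 1\<close>.\<close>
  define x where "x = (\<lambda>e\<in>U. if a e \<noteq> 0 then a e else if b e \<noteq> 0 then b e else 1)"
  have "x \<in> orthants U k"
    using a b k by (auto simp: x_def orthants_def partial_solutions_def PiE_iff)
  moreover have "in_orthant U a x" "in_orthant U b x"
    using compat by (fastforce simp: in_orthant_def x_def)+
  ultimately show ?thesis
    using sub a b unfolding submodular_in_every_orthant_def by blast
qed

text \<open>The induction compares both sides with the mixed vector \<open>?w\<close>, which takes
  \<open>p\<close> on \<open>D\<close> and \<open>q\<close> at the new \<open>e\<close>. The base
  \<open>m\<close> stays arbitrary because the induction hypothesis is used at
  \<open>?v\<close>.\<close>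

lemma pairwise_monotone_override_on:
  assumes sub: "submodular_in_every_orthant U k f" and mono: "pairwise_monotone U k f"
    and k: "k \<ge> 1"
    and p: "p \<in> partial_solutions U k" and q: "q \<in> partial_solutions U k"
    and "finite D" "D \<subseteq> U"
    and "\<And>e. e \<in> D \<Longrightarrow> p e \<noteq> 0 \<and> q e \<noteq> 0 \<and> p e \<noteq> q e"
    and "m \<in> partial_solutions U k" "\<And>e. e \<in> D \<Longrightarrow> m e = 0"
  shows "f (override_on m p D) + f (override_on m q D) \<ge> 2 * f m"
  using assms(6-)
proof (induction D arbitrary: m rule: finite_induct)
  case empty
  then show ?case by simp
next
  case (insert e D)
  let ?u = "override_on m p D" and ?v = "override_on m q {e}"
  let ?w = "override_on ?v p D"
  note D = insert.prems(1,2) and m = insert.prems(3) and m0 = insert.prems(4)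
  have u: "?u \<in> partial_solutions U k" and v: "?v \<in> partial_solutions U k"
    using m p q by (auto intro: override_on_partial_solutions)
  have e: "e \<in> U" "?u e = 0" using insert.hyps D m0 by (auto simp: override_on_def)
  have range: "p e \<in> {1..k}" "q e \<in> {1..k}" "p e \<noteq> q e"
    using D(2)[of e] e p q by (auto simp: partial_solutions_def PiE_iff Suc_le_eq)
  have "marginal f (p e) e ?u + marginal f (q e) e ?u \<ge> 0"
    using mono u e range unfolding pairwise_monotone_def by blast
  moreover have "?u(e := ?u e + p e) = override_on m p (insert e D)"
    using e(2) by (auto simp: override_on_def fun_eq_iff)
  moreover have "?u(e := ?u e + q e) = ?w"
    using e(2) insert.hyps by (auto simp: override_on_def fun_eq_iff)
  ultimately have 1: "f (override_on m p (insert e D)) + f ?w \<ge> 2 * f ?u"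
    by (simp add: marginal_def)
  have "f ?w + f (override_on ?v q D) \<ge> 2 * f ?v"
    using D m0 v insert.hyps by (intro insert.IH) (auto simp: override_on_def)
  moreover have "override_on ?v q D = override_on m q (insert e D)"
    by (auto simp: override_on_def fun_eq_iff)
  ultimately have 2: "f ?w + f (override_on m q (insert e D)) \<ge> 2 * f ?v"
    by simp
  \<comment> \<open>\<open>?u\<close> and \<open>?v\<close> alter \<open>m\<close> on the disjoint
    sets \<open>D\<close> and \<open>{e}\<close>, where \<open>m\<close> is zero, so they never
    conflict.\<close>
  have "f ?u + f ?v \<ge> f (vmin0 U ?u ?v) + f (vmax0 U ?u ?v)"
    using sub k u v
    by (rule submodular_in_every_orthantD) (use m0 e(2) in \<open>auto simp: override_on_def\<close>)
  moreover have "vmin0 U ?u ?v = m" "vmax0 U ?u ?v = ?w"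
    using m D(1) m0 e insert.hyps
    by (auto simp: vmin0_def vmax0_def min0_def max0_def override_on_def fun_eq_iff
        partial_solutions_def PiE_iff extensional_def)
  ultimately have 3: "f ?u + f ?v \<ge> f m + f ?w"
    by simp
  \<comment> \<open>Adding \<open>1\<close>, \<open>2\<close> and twice \<open>3\<close> cancels
    \<open>?u\<close>, \<open>?v\<close> and \<open>?w\<close>.\<close>
  from 1 2 3 show ?case by linarith
qed

text \<open>Distinct nonzero values at \<open>e\<close> conflict, so \<open>min0\<close> and
  \<open>max0\<close> both reset that coordinate and return \<open>s\<close>.\<close>

lemma k_submodular_imp_pairwise_monotone:
  assumes "k_submodular U k f"
  shows "pairwise_monotone U k f"
  unfolding pairwise_monotone_def
proof (intro ballI impI)
  fix e s i j
  assume e: "e \<in> U" and s: "s \<in> partial_solutions U k" and s0: "s e = 0"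
    and ij: "i \<in> {1..k}" "j \<in> {1..k}" "i \<noteq> j"
  have "s(e := i) \<in> partial_solutions U k" "s(e := j) \<in> partial_solutions U k"
    using s e ij by (auto simp: partial_solutions_def PiE_iff extensional_def)
  moreover have "vmin0 U (s(e := i)) (s(e := j)) = s" "vmax0 U (s(e := i)) (s(e := j)) = s"
    using s e s0 ij
    by (auto simp: vmin0_def vmax0_def min0_def max0_def fun_eq_iff
        partial_solutions_def PiE_iff extensional_def)
  ultimately have "f (s(e := i)) + f (s(e := j)) \<ge> f s + f s"
    using assms unfolding k_submodular_def by metis
  then show "marginal f i e s + marginal f j e s \<ge> 0"
    by (simp add: marginal_def s0)
qed

lemma k_submodularI:
  assumes sub: "submodular_in_every_orthant U k f" and mono: "pairwise_monotone U k f"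
    and k: "k \<ge> 1" and "finite U"
  shows "k_submodular U k f"
  unfolding k_submodular_def
proof (intro ballI)
  fix a b
  assume a: "a \<in> partial_solutions U k" and b: "b \<in> partial_solutions U k"
  define D where "D = {e \<in> U. a e \<noteq> 0 \<and> b e \<noteq> 0 \<and> a e \<noteq> b e}"
  define m where "m = vmax0 U a b"
  define zero where "zero = (\<lambda>e\<in>U. 0 :: nat)"
  let ?a = "override_on a zero D" and ?b = "override_on b zero D"
  note defs = vmin0_def vmax0_def min0_def max0_def override_on_def D_def zero_def
  have m: "m \<in> partial_solutions U k"
    using a b by (simp add: m_def vmax0_closed)
  have zero: "zero \<in> partial_solutions U k"
    by (simp add: zero_def partial_solutions_def)
  have a0: "?a \<in> partial_solutions U k" and b0: "?b \<in> partial_solutions U k"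
    using a b zero by (auto intro: override_on_partial_solutions)
  have "f ?a + f ?b \<ge> f (vmin0 U ?a ?b) + f (vmax0 U ?a ?b)"
    using sub k a0 b0 by (rule submodular_in_every_orthantD) (auto simp: defs)
  \<comment> \<open>Zeroing \<open>D\<close> loses nothing here, as \<open>min0\<close> and
    \<open>max0\<close> already vanish at conflicts.\<close>
  moreover have "vmin0 U ?a ?b = vmin0 U a b" "vmax0 U ?a ?b = m"
    by (auto simp: m_def defs fun_eq_iff)
  ultimately have ab0: "f ?a + f ?b \<ge> f (vmin0 U a b) + f m"
    by simp
  \<comment> \<open>\<open>m\<close> is zero on \<open>D\<close> and agrees with \<open>a\<close>
    wherever else \<open>a\<close> is nonzero, so \<open>a\<close> and \<open>m\<close> do not
    conflict.\<close>
  have "f a + f m \<ge> f (vmin0 U a m) + f (vmax0 U a m)"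
    using sub k a m by (rule submodular_in_every_orthantD) (auto simp: m_def defs)
  moreover have "vmin0 U a m = ?a" "vmax0 U a m = override_on m a D"
    using a by (auto simp: m_def defs fun_eq_iff partial_solutions_def PiE_iff extensional_def)
  ultimately have am: "f a + f m \<ge> f ?a + f (override_on m a D)"
    by simp
  have "f b + f m \<ge> f (vmin0 U b m) + f (vmax0 U b m)"
    using sub k b m by (rule submodular_in_every_orthantD) (auto simp: m_def defs)
  moreover have "vmin0 U b m = ?b" "vmax0 U b m = override_on m b D"
    using b by (auto simp: m_def defs fun_eq_iff partial_solutions_def PiE_iff extensional_def)
  ultimately have bm: "f b + f m \<ge> f ?b + f (override_on m b D)"
    by simp
  have "f (override_on m a D) + f (override_on m b D) \<ge> 2 * f m"
    using sub mono k a b _ _ _ m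
    by (rule pairwise_monotone_override_on) (use \<open>finite U\<close> in \<open>auto simp: m_def defs\<close>)
  \<comment> \<open>In the sum of all four inequalities \<open>?a\<close>, \<open>?b\<close> and
    both overrides of \<open>m\<close> cancel, and one \<open>f m\<close> survives on the smaller
    side.\<close>
  with ab0 am bm show "f (vmin0 U a b) + f (vmax0 U a b) \<le> f a + f b"
    unfolding m_def by linarith
qed

theorem theorem7:
  fixes k :: nat and U :: "'u set" and f :: "('u \<Rightarrow> nat) \<Rightarrow> real"
  assumes "k \<ge> 2" and "finite U" and "U \<noteq> {}"
    and "f \<in> partial_solutions U k \<rightarrow> {0..}"
  shows "k_submodular U k f \<longleftrightarrow> submodular_in_every_orthant U k f \<and> pairwise_monotone U k f"
proof
  assume "k_submodular U k f"
  then show "submodular_in_every_orthant U k f \<and> pairwise_monotone U k f"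
    by (auto simp: k_submodular_def submodular_in_every_orthant_def
        intro: k_submodular_imp_pairwise_monotone)
next
  assume "submodular_in_every_orthant U k f \<and> pairwise_monotone U k f"
  then show "k_submodular U k f"
    using assms(1,2) by (intro k_submodularI) auto
qed

end
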